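(* Let $\lambda\ge 1$ be an integer and let $G$ be a graph of order $n$ and minimum degree $\delta$. Let $C$ be a longest cycle in $G$, and let $\overline{c}$ denote the length of a longest cycle in $G\setminus C$. If $$\delta\ge \frac{n+2}{\lambda+1}+\lambda-2,$$ then either $\overline{c}\le \min\{\lambda-1,\ \delta-\lambda\}$ or $\overline{c}\ge \max\{\lambda+1,\ \delta-\lambda+2\}$.
   Context: All graphs are finite, undirected, without loops or multiple edges; no connectivity assumption is made on $G$. $G\setminus C$ denotes the graph obtained from $G$ by deleting the vertices of $C$. The length of a cycle is its number of edges; by convention a single vertex is regarded as a cycle of length $1$ and a single edge as a cycle of length $2$. If $G\setminus C$ is empty, $\overline{c}=0$. *)

theory Defs
  imports Complex_Main "Graph_Theory.Graph_Theory"
begin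

(* Finite simple graphs are given by the locale graph (finite symmetric digraphs without
   loops and parallel arcs): every edge uv is represented by the two arcs (u,v) and (v,u),
   so the out-degree of a vertex is its usual degree. *)

definition min_degree :: "('a, 'b) pre_digraph \<Rightarrow> nat" where
  "min_degree G = Min (out_degree G ` verts G)"

(* A cycle is listed by its vertices, each occurring once, so that its length is the length
   of the list. A single vertex is a cycle of length 1, and, as arcs come in opposite pairs,
   an edge uv is a cycle [u, v] of length 2. *)
definition graph_cycle :: "('a, 'b) pre_digraph \<Rightarrow> 'a list \<Rightarrow> bool" where
  "graph_cycle G p \<longleftrightarrow> vpath p G \<and> (length p \<ge> 2 \<longrightarrow> last p \<rightarrow>\<^bsub>G\<^esub> hd p)"

definition longest_cycle :: "('a, 'b) pre_digraph \<Rightarrow> 'a list \<Rightarrow> bool" where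
  "longest_cycle G p \<longleftrightarrow> graph_cycle G p \<and> (\<forall>q. graph_cycle G q \<longrightarrow> length q \<le> length p)"

definition circumference :: "('a, 'b) pre_digraph \<Rightarrow> nat" where
  "circumference G =
     (if verts G = {} then 0 else Max (length ` {p. graph_cycle G p}))"

end

theory Submission
  imports Defs
begin

text \<open>
  Let \<open>c\<close> be the length of \<open>C\<close>, let \<open>\<Gamma>\<close> be \<open>G\<close> without \<open>C\<close>, and let \<open>H\<close> be a longest cycle of
  \<open>\<Gamma>\<close>, of length \<open>h\<close>. The main point is the bound \<open>c \<ge> (h + 1) (\<delta> - h + 1)\<close>. With
  \<open>n \<ge> c + h\<close> it says \<open>n + 2 > f h\<close> for the concave function \<open>f x = (x + 1) (\<delta> - x + 2)\<close>, whereas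
  the hypothesis says \<open>n + 2 \<le> f \<lambda>\<close>; since \<open>f \<lambda> - f h = (\<lambda> - h) (\<delta> + 1 - \<lambda> - h)\<close>, both
  factors have the same sign.

  For the bound, attach to the vertices of \<open>H\<close> pairwise disjoint paths in \<open>\<Gamma>\<close> that are as long as
  possible in total. Their ends have on average about \<open>h - 1\<close> neighbours in \<open>\<Gamma>\<close>, as otherwise
  \<open>H\<close> could be extended, so they have together about \<open>h (\<delta> - h + 1)\<close> neighbours on \<open>C\<close>. Two ends
  are connected by a path through \<open>\<Gamma>\<close> that uses the longer arc of \<open>H\<close>, which keeps their
  neighbours on \<open>C\<close> apart. The average above can be exceeded only because of paths longer
  than \<open>h / 2\<close>, and these keep the neighbours even further apart.
\<close>

section \<open>Paths and cycles as vertex lists\<close>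

locale sgraph =
  fixes E :: "'a \<Rightarrow> 'a \<Rightarrow> bool"
  assumes sym: "E x y \<Longrightarrow> E y x"
    and irrefl: "\<not> E x x"
begin

text \<open>The set \<open>A\<close> plays the part of an induced subgraph, so that paths of G and
  of G without C share one relation \<open>E\<close>.\<close>

definition gpath :: "'a set \<Rightarrow> 'a list \<Rightarrow> bool" where
  "gpath A xs \<longleftrightarrow> xs \<noteq> [] \<and> distinct xs \<and> set xs \<subseteq> A \<and> successively E xs"

definition gcycle :: "'a set \<Rightarrow> 'a list \<Rightarrow> bool" where
  "gcycle A xs \<longleftrightarrow> gpath A xs \<and> (2 \<le> length xs \<longrightarrow> E (last xs) (hd xs))"

definition longest :: "'a set \<Rightarrow> 'a list \<Rightarrow> bool" where
  "longest A xs \<longleftrightarrow> gcycle A xs \<and> (\<forall>ys. gcycle A ys \<longrightarrow> length ys \<le> length xs)"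

definition nbrs :: "'a set \<Rightarrow> 'a \<Rightarrow> 'a set" where
  "nbrs A v = {x \<in> A. E v x}"

lemma E_commute: "E x y \<longleftrightarrow> E y x"
  using sym by blast

lemma gpath_singleton [simp]: "gpath A [x] \<longleftrightarrow> x \<in> A"
  by (auto simp: gpath_def)

lemma gpath_mono: "gpath A xs \<Longrightarrow> A \<subseteq> B \<Longrightarrow> gpath B xs"
  by (auto simp: gpath_def)

lemma gpath_append:
  assumes "gpath A xs" "gpath A ys" "set xs \<inter> set ys = {}" "E (last xs) (hd ys)"
  shows "gpath A (xs @ ys)"
  using assms by (auto simp: gpath_def successively_append_iff)

lemma gpath_rev: "gpath A xs \<Longrightarrow> gpath A (rev xs)"
  by (simp add: gpath_def E_commute)

lemma gpath_prefix: "gpath A (xs @ ys) \<Longrightarrow> xs \<noteq> [] \<Longrightarrow> gpath A xs"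
  by (auto simp: gpath_def successively_append_iff)

lemma gpath_suffix: "gpath A (xs @ ys) \<Longrightarrow> ys \<noteq> [] \<Longrightarrow> gpath A ys"
  by (auto simp: gpath_def successively_append_iff)

lemma gpath_take: "gpath A xs \<Longrightarrow> 0 < k \<Longrightarrow> gpath A (take k xs)"
  using gpath_prefix[of A "take k xs" "drop k xs"] by (auto simp: gpath_def)

lemma gpath_drop: "gpath A xs \<Longrightarrow> k < length xs \<Longrightarrow> gpath A (drop k xs)"
  using gpath_suffix[of A "take k xs" "drop k xs"] by auto

lemma gpath_nth_Suc: "gpath A xs \<Longrightarrow> Suc k < length xs \<Longrightarrow> E (xs ! k) (xs ! Suc k)"
  by (auto simp: gpath_def successively_conv_nth)

lemma gpath_length_le:
  assumes "gpath A xs" "finite A" shows "length xs \<le> card A"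
  using assms by (metis gpath_def distinct_card card_mono)

end

section \<open>Arcs between cyclic positions\<close>

text \<open>The length of the arc of a cycle of length \<open>h\<close> leading forward from position \<open>i\<close> to
  position \<open>j\<close>; it is \<open>h\<close>, not \<open>0\<close>, for \<open>i = j\<close>.\<close>

definition fwd :: "nat \<Rightarrow> nat \<Rightarrow> nat \<Rightarrow> nat" where
  "fwd h i j = (if i < j then j - i else h - (i - j))"

lemma fwd_add_fwd: "i < h \<Longrightarrow> j < h \<Longrightarrow> i \<noteq> j \<Longrightarrow> fwd h i j + fwd h j i = h"
  by (auto simp: fwd_def)

lemma fwd_Suc_mod: "i < h \<Longrightarrow> fwd h i (Suc i mod h) = 1"
  by (cases "Suc i = h") (auto simp: fwd_def)

lemma sum_Suc_mod:
  fixes f :: "nat \<Rightarrow> 'b :: comm_monoid_add"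
  shows "(\<Sum>i<n. f (Suc i mod n)) = (\<Sum>i<n. f i)"
proof (cases n)
  case (Suc m)
  have "(\<Sum>i<n. f (Suc i mod n)) = (\<Sum>i<m. f (Suc i)) + f 0"
    by (simp add: Suc)
  then show ?thesis
    by (simp only: Suc sum.lessThan_Suc_shift add.commute)
qed simp

text \<open>The arcs between cyclically consecutive positions tile the cycle. A single position
  contributes the whole cycle, which is why \<open>fwd c i i\<close> has to be
  \<open>c\<close>.\<close>

lemma sum_fwd_strict_mono:
  assumes "sorted_wrt (<) ms" "ms \<noteq> []" "set ms \<subseteq> {..<c}"
  shows "(\<Sum>i<length ms. fwd c (ms ! i) (ms ! (Suc i mod length ms))) = c"
proof -
  obtain m where m: "length ms = Suc m"
    using assms(2) by (cases ms) auto
  have mono: "ms ! i < ms ! j" if "i < j" "j \<le> m" for i j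
    using sorted_wrt_nth_less[OF assms(1)] that m by auto
  have bound: "ms ! i < c" if "i \<le> m" for i
    using assms(3) that m nth_mem[of i ms] by (metis in_mono le_imp_less_Suc lessThan_iff)
  have "(\<Sum>i<k. ms ! Suc i - ms ! i) = ms ! k - ms ! 0" if "k \<le> m" for k
    using that
  proof (induction k)
    case (Suc k)
    then show ?case
      using mono[of k "Suc k"] mono[of 0 k] by (cases "k = 0") auto
  qed simp
  moreover have "(\<Sum>i<m. fwd c (ms ! i) (ms ! (Suc i mod length ms)))
      = (\<Sum>i<m. ms ! Suc i - ms ! i)"
    using mono m by (intro sum.cong) (auto simp: fwd_def)
  moreover have "fwd c (ms ! m) (ms ! 0) = c - (ms ! m - ms ! 0)"
    using mono[of 0 m] by (cases "m = 0") (auto simp: fwd_def)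
  ultimately show ?thesis
    using bound[of m] by (simp add: m)
qed

lemma cyclic_induct:
  assumes "i < n" "P i" "\<And>k. k < n \<Longrightarrow> P k \<Longrightarrow> P (Suc k mod n)" "j < n"
  shows "P j"
proof -
  have "P ((i + t) mod n)" for t
  proof (induction t)
    case (Suc t)
    then show ?case
      using assms(3)[of "(i + t) mod n"] assms(1) by (simp add: mod_Suc_eq)
  qed (use assms in auto)
  from this[of "j + n - i"] show ?thesis
    using assms by simp
qed

text \<open>Adding the hypothesis over consecutive elements of \<open>K\<close> telescopes on the
  right and counts every \<open>z k\<close> twice on the left, except those at the two extremes,
  which are therefore added.\<close>

lemma double_sum_le_spread:
  assumes "finite K" "K \<noteq> {}"
    and "\<And>k l. k \<in> K \<Longrightarrow> l \<in> K \<Longrightarrow> k < l \<Longrightarrow> z k + z l \<le> l - k"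
  shows "2 * (\<Sum>k\<in>K. z k) \<le> Max K - Min K + z (Min K) + (z (Max K) :: nat)"
  using assms
proof (induction K rule: finite_linorder_max_induct)
  case (insert b A)
  show ?case
  proof (cases "A = {}")
    case False
    define M where "M = Max A"
    define m where "m = Min A"
    have in_A: "M \<in> A" "m \<in> A"
      using False insert.hyps by (auto simp: M_def m_def)
    have Max: "Max (insert b A) = b" and Min: "Min (insert b A) = m"
      using insert.hyps False in_A
      by (auto simp: m_def min_def intro!: Max_eqI dest: order.strict_trans1 less_imp_le)
    have "m \<le> M"
      using in_A insert.hyps by (simp add: M_def)
    moreover have "b \<notin> A" "M < b"
      using insert.hyps in_A by auto
    moreover have "z M + z b \<le> b - M"
      using insert.prems(2)[of M b] in_A \<open>M < b\<close> by simp
    moreover have "2 * (\<Sum>k\<in>A. z k) \<le> M - m + z m + z M"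
      using insert.IH False insert.prems(2) by (simp add: M_def m_def)
    ultimately show ?thesis
      unfolding Max Min using insert.hyps by simp
  qed simp
qed simp

context sgraph
begin

text \<open>This arc runs forward from position \<open>j\<close> to position \<open>i\<close>, so it
  is what remains of the cycle when the interior of the arc from \<open>i\<close> to
  \<open>j\<close> is removed.\<close>

lemma cycle_arc:
  assumes "gcycle A xs" "i < length xs" "j < length xs"
  obtains ys where "gpath A ys" "hd ys = xs ! j" "last ys = xs ! i" "set ys \<subseteq> set xs"
    "length ys + fwd (length xs) i j = length xs + 1"
proof (cases "i < j")
  case True
  let ?ys = "drop j xs @ take (Suc i) xs"
  have p: "gpath A xs" and e: "E (last xs) (hd xs)"
    using assms True by (auto simp: gcycle_def)
  have "set (drop j xs) \<inter> set (take (Suc i) xs) = {}"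
    using p True set_take_disj_set_drop_if_distinct[of xs "Suc i" j] by (auto simp: gpath_def)
  then have "gpath A ?ys"
    using p e assms by (intro gpath_append) (auto intro: gpath_drop gpath_take)
  moreover have "hd ?ys = xs ! j" "last ?ys = xs ! i"
    using assms by (auto simp: hd_append hd_drop_conv_nth take_Suc_conv_app_nth)
  moreover have "set ?ys \<subseteq> set xs"
    by (auto dest: in_set_dropD in_set_takeD)
  moreover have "length ?ys + fwd (length xs) i j = length xs + 1"
    using assms True by (auto simp: fwd_def)
  ultimately show ?thesis by (rule that)
next
  case False
  let ?ys = "drop j (take (Suc i) xs)"
  have "gpath A ?ys"
    using assms False by (intro gpath_drop gpath_take) (auto simp: gcycle_def)
  moreover have "hd ?ys = xs ! j"
    using assms False by (subst hd_drop_conv_nth) auto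
  moreover have "last ?ys = xs ! i"
    using assms False by (simp add: take_Suc_conv_app_nth)
  moreover have "set ?ys \<subseteq> set xs"
    by (auto dest: in_set_dropD in_set_takeD)
  moreover have "length ?ys + fwd (length xs) i j = length xs + 1"
    using assms False by (auto simp: fwd_def)
  ultimately show ?thesis by (rule that)
qed

text \<open>Replacing the arc from \<open>i\<close> to \<open>j\<close> by \<open>P\<close> gives
  another cycle, which cannot be longer. The case \<open>i = j\<close> is included: there the cycle
  consists of \<open>P\<close> and one vertex of \<open>Z\<close>. The lemma is applied both to C
  and to H.\<close>

lemma longest_detour:
  assumes "longest A Z" "i < length Z" "j < length Z"
    and "gpath A P" "set P \<inter> set Z = {}" "E (Z ! i) (hd P)" "E (last P) (Z ! j)"
  shows "length P + 1 \<le> fwd (length Z) i j"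
proof -
  obtain ys where ys: "gpath A ys" "hd ys = Z ! j" "last ys = Z ! i" "set ys \<subseteq> set Z"
    "length ys + fwd (length Z) i j = length Z + 1"
    using cycle_arc assms(1-3) unfolding longest_def by metis
  have "gpath A (ys @ P)"
    using ys assms by (intro gpath_append) auto
  then have "gcycle A (ys @ P)"
    using ys assms by (auto simp: gpath_def gcycle_def)
  then have "length ys + length P \<le> length Z"
    using assms(1) unfolding longest_def by fastforce
  then show ?thesis
    using ys(5) by simp
qed

end

section \<open>Counting the neighbours of a family of paths on a cycle\<close>

text \<open>The cyclic shift of \<open>A\<close> has the size of \<open>A\<close> and is disjoint
  from \<open>B\<close>.\<close>

lemma card_add_card_le_cyclic:
  assumes "A \<subseteq> {..<h}" "B \<subseteq> {..<h}" "\<And>i. i \<in> A \<Longrightarrow> Suc i mod h \<notin> B"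
  shows "card A + card B \<le> h"
proof -
  have "card A + card B = (\<Sum>i<h. of_bool (i \<in> A)) + (\<Sum>i<h. of_bool (i \<in> B))"
    using assms(1,2) by (simp add: Int_absorb1)
  also have "\<dots> = (\<Sum>i<h. of_bool (i \<in> A) + of_bool (Suc i mod h \<in> B))"
    by (simp only: sum.distrib sum_Suc_mod[of "\<lambda>i. of_bool (i \<in> B)" h])
  also have "\<dots> \<le> (\<Sum>i<h. 1)"
    using assms(3) by (intro sum_mono) auto
  finally show ?thesis by simp
qed

text \<open>Here \<open>g\<close> is the gap between two consecutive marked positions of C, and
  \<open>S\<close>, \<open>S'\<close> are their index sets. Summed over all segments, every index
  set occurs twice, hence the factor 2 on the right.\<close>

lemma segment_weight:
  assumes "S \<subseteq> {..<h}" "S' \<subseteq> {..<h}" "S \<noteq> {}" "S' \<noteq> {}"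
    and same: "\<And>i. i \<in> S \<Longrightarrow> i \<in> S' \<Longrightarrow> 2 \<le> g"
    and diff: "\<And>i i'. i \<in> S \<Longrightarrow> i' \<in> S' \<Longrightarrow> i \<noteq> i' \<Longrightarrow> fwd h i i' + 2 \<le> g \<and> fwd h i' i + 2 \<le> g"
  shows "(h + 1) * (card S + card S') \<le> 2 * h * g"
proof -
  have fin: "finite S" "finite S'"
    using assms(1,2) finite_subset by blast+
  have le_h: "card S \<le> h" "card S' \<le> h"
    using assms(1,2) card_mono[of "{..<h}"] by fastforce+
  have "h \<noteq> 0"
    using assms(1,3) by auto
  consider (eq) k where "S = {k}" "S' = {k}" | (ne) i i' where "i \<in> S" "i' \<in> S'" "i \<noteq> i'"
    using assms(3,4) by (cases "\<exists>k. S = {k} \<and> S' = {k}") blast+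
  then show ?thesis
  proof cases
    case eq
    then have "2 \<le> g"
      using same by blast
    have "(h + 1) * 2 \<le> 2 * h * 2"
      using \<open>h \<noteq> 0\<close> by simp
    also have "\<dots> \<le> 2 * h * g"
      using \<open>2 \<le> g\<close> by (intro mult_le_mono) auto
    finally show ?thesis
      using eq by simp
  next
    case ne
    show ?thesis
    proof (cases "\<exists>k \<in> S. Suc k mod h \<in> S'")
      case True
      then obtain k where k: "k \<in> S" "Suc k mod h \<in> S'" by blast
      have "k < h" using k assms(1) by auto
      have "h \<noteq> 1" using ne assms(1,2) by (auto simp: subset_iff)
      then have "k \<noteq> Suc k mod h"
        using \<open>k < h\<close> by (cases "Suc k = h") auto
      \<comment> \<open>The longer arc between neighbouring positions has h - 1 edges.\<close>
      then have "h + 1 \<le> g"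
        using diff[OF k] fwd_Suc_mod[OF \<open>k < h\<close>] fwd_add_fwd[of k h "Suc k mod h"] \<open>k < h\<close> by auto
      then have "(h + 1) * (card S + card S') \<le> g * (2 * h)"
        using le_h by (intro mult_le_mono) auto
      then show ?thesis by (simp add: ac_simps)
    next
      case False
      then have s: "card S + card S' \<le> h"
        using card_add_card_le_cyclic[OF assms(1,2)] by blast
      have "i < h" "i' < h"
        using ne assms(1,2) by auto
      \<comment> \<open>The two arcs add up to h, so the longer one has at least h/2 edges; this
        suffices because the index sets now have only h elements together.\<close>
      then have "h + 4 \<le> 2 * g"
        using diff[OF ne] fwd_add_fwd[of i h i'] ne by simp
      then have "(h + 1) * (card S + card S') \<le> (2 * g) * h"
        using s by (intro mult_le_mono) auto
      then show ?thesis by (simp add: ac_simps)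
    qed
  qed
qed

lemma segment_gap_heavy:
  assumes "i < h" "j < h" "i \<noteq> j" "h + 1 \<le> 2 * q"
    and "q + fwd h i j + 2 \<le> g" "q + fwd h j i + 2 \<le> g"
  shows "h + 3 \<le> g"
  using fwd_add_fwd[of i h j] assms by simp

lemma segment_weight_heavy:
  assumes "card S' \<le> h" "h + 3 \<le> g" "2 * r + 2 \<le> h"
  shows "(h + 1) * (1 + card S') + 2 * (h + 1) * r \<le> 2 * h * (g :: nat)"
proof -
  have "(h + 1) * (1 + card S') + 2 * (h + 1) * r = (h + 1) * (1 + card S' + 2 * r)"
    by (simp add: algebra_simps)
  also have "\<dots> \<le> (h + 1) * (2 * h)"
    using assms by (intro mult_le_mono) auto
  also have "\<dots> \<le> g * (2 * h)"
    using assms by (intro mult_le_mono) auto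
  finally show ?thesis by (simp add: ac_simps)
qed

text \<open>Position \<open>p\<close> of a cycle of length \<open>c\<close> carries the set \<open>S p\<close> of those indices \<open>i < h\<close> whose
  path has its end adjacent to that position; \<open>q i\<close> is the length of path \<open>i\<close>. The indices in \<open>B\<close>
  belong to paths so long that the segments next to their ends have room to spare, which pays
  for the additional weights \<open>r\<close>.\<close>

lemma marked_cycle_weight:
  fixes S :: "nat \<Rightarrow> nat set" and q r :: "nat \<Rightarrow> nat"
  assumes sub: "\<And>p. p < c \<Longrightarrow> S p \<subseteq> {..<h}"
    and diff: "\<And>p p' i i'. \<lbrakk>p < c; p' < c; i \<in> S p; i' \<in> S p'; i \<noteq> i'\<rbrakk> \<Longrightarrow>
      q i + q i' + fwd h i i' + 2 \<le> fwd c p p' \<and> q i + q i' + fwd h i' i + 2 \<le> fwd c p p'"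
    and same: "\<And>p p' i. \<lbrakk>p < c; p' < c; i \<in> S p; i \<in> S p'\<rbrakk> \<Longrightarrow> 2 \<le> fwd c p p'"
    and B: "B \<subseteq> {..<h}" "\<And>j. j \<in> B \<Longrightarrow> h + 1 \<le> 2 * q j" "\<And>j. j \<in> B \<Longrightarrow> 2 * r j + 2 \<le> h"
    and ne: "p0 < c" "S p0 \<noteq> {}"
  obtains (total) "(h + 1) * ((\<Sum>p<c. card (S p)) + (\<Sum>j\<in>B. r j)) \<le> h * c"
    | (single) j where "j \<in> B" "\<And>p. p < c \<Longrightarrow> S p \<subseteq> {j}"
    | (heavy) j where "j \<in> B" "(h + 1) * card {p. p < c \<and> j \<in> S p} \<le> c"
proof -
  define ms where "ms = filter (\<lambda>p. S p \<noteq> {}) [0..<c]"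
  define n where "n = length ms"
  define T where "T i = S (ms ! i)" for i
  define g where "g i = fwd c (ms ! i) (ms ! (Suc i mod n))" for i
  have set_ms: "set ms = {p. p < c \<and> S p \<noteq> {}}"
    by (auto simp: ms_def)
  have "ms \<noteq> []"
    using ne set_ms by (auto simp flip: set_empty)
  then have "n > 0" by (simp add: n_def)
  have sum_g: "(\<Sum>i<n. g i) = c"
    unfolding n_def g_def
    using \<open>ms \<noteq> []\<close> set_ms
    by (intro sum_fwd_strict_mono) (auto simp: ms_def intro!: sorted_wrt_filter)
  have bij: "bij_betw ((!) ms) {..<n} (set ms)"
    unfolding n_def by (intro bij_betw_nth) (auto simp: ms_def)
  have ms: "ms ! i < c" "T i \<noteq> {}" "T i \<subseteq> {..<h}" if "i < n" for i
    using nth_mem[of i ms] that sub by (auto simp: set_ms n_def T_def)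
  have suc: "Suc i mod n < n" for i
    using \<open>n > 0\<close> by simp
  have gap_heavy: "h + 3 \<le> g i" if i: "i < n" and j: "j \<in> B" "j \<in> T i" "T (Suc i mod n) \<noteq> {j}" for i j
  proof -
    obtain k where k: "k \<in> T (Suc i mod n)" "k \<noteq> j"
      using ms(2)[OF suc[of i]] j by blast
    then have "q j + q k + fwd h j k + 2 \<le> g i \<and> q j + q k + fwd h k j + 2 \<le> g i"
      unfolding g_def using diff[of "ms ! i" "ms ! (Suc i mod n)" j k] ms i suc j
      by (auto simp: T_def)
    moreover have "j < h" "k < h"
      using k ms(3)[OF i] ms(3)[OF suc[of i]] j by auto
    ultimately show ?thesis
      using B(2)[OF j(1)] k by (intro segment_gap_heavy[of j h k "q j"]) auto
  qed
  show thesis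
  \<comment> \<open>If possible, \<open>r j\<close> is charged to a segment that starts at a mark
    \<open>{j}\<close> and ends at a different mark. Distinct \<open>j\<close> use distinct
    segments, since the mark determines \<open>j\<close>.\<close>
  proof (cases "\<forall>j\<in>B. \<exists>i<n. T i = {j} \<and> T (Suc i mod n) \<noteq> {j}")
    case True
    then obtain f where f: "\<And>j. j \<in> B \<Longrightarrow> f j < n \<and> T (f j) = {j} \<and> T (Suc (f j) mod n) \<noteq> {j}"
      by metis
    have inj: "inj_on f B"
      using f by (metis inj_onI singleton_inject)
    define w where "w i = (if i \<in> f ` B then 2 * (h + 1) * r (the_elem (T i)) else 0)" for i
    have "(h + 1) * (card (T i) + card (T (Suc i mod n))) + w i \<le> 2 * h * g i" if i: "i < n" for i
    proof (cases "i \<in> f ` B")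
      case True
      then obtain j where j: "j \<in> B" "i = f j" by blast
      have "card (T (Suc i mod n)) \<le> h"
        using card_mono[OF _ ms(3)[OF suc]] by simp
      then show ?thesis
        using segment_weight_heavy[of "T (Suc i mod n)" h "g i" "r j"] gap_heavy[of i j] B(3) f j i
        by (simp add: w_def)
    next
      case False
      have "(h + 1) * (card (T i) + card (T (Suc i mod n))) \<le> 2 * h * g i"
      proof (rule segment_weight)
        show "2 \<le> g i" if "k \<in> T i" "k \<in> T (Suc i mod n)" for k
          using same[of "ms ! i" "ms ! (Suc i mod n)" k] ms i suc that by (auto simp: T_def g_def)
        show "fwd h k k' + 2 \<le> g i \<and> fwd h k' k + 2 \<le> g i"
          if "k \<in> T i" "k' \<in> T (Suc i mod n)" "k \<noteq> k'" for k k'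
          using diff[of "ms ! i" "ms ! (Suc i mod n)" k k'] ms i suc that
          by (fastforce simp: T_def g_def)
      qed (use ms i suc in auto)
      then show ?thesis using False by (simp add: w_def)
    qed
    then have "(\<Sum>i<n. (h + 1) * (card (T i) + card (T (Suc i mod n))) + w i) \<le> (\<Sum>i<n. 2 * h * g i)"
      by (intro sum_mono) auto
    then have "(h + 1) * ((\<Sum>i<n. card (T i)) + (\<Sum>i<n. card (T (Suc i mod n)))) + (\<Sum>i<n. w i)
        \<le> 2 * h * c"
      by (simp only: sum.distrib flip: sum_g sum_distrib_left)
    moreover have "(\<Sum>i<n. w i) = (\<Sum>i\<in>f ` B. w i)"
      using f by (intro sum.mono_neutral_right) (auto simp: w_def)
    moreover have "(\<Sum>i\<in>f ` B. w i) = 2 * (h + 1) * (\<Sum>j\<in>B. r j)"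
      using f by (simp add: sum.reindex[OF inj] w_def sum_distrib_left)
    moreover have "(\<Sum>i<n. card (T i)) = (\<Sum>p\<in>set ms. card (S p))"
      unfolding T_def by (rule sum.reindex_bij_betw[OF bij])
    moreover have "\<dots> = (\<Sum>p<c. card (S p))"
      by (intro sum.mono_neutral_left) (auto simp: set_ms)
    ultimately have "2 * ((h + 1) * ((\<Sum>p<c. card (S p)) + (\<Sum>j\<in>B. r j))) \<le> 2 * (h * c)"
      using sum_Suc_mod[of "\<lambda>i. card (T i)" n] by (simp add: algebra_simps)
    then show thesis
      by (intro total) simp
  next
    case False
    then obtain j where j: "j \<in> B" "\<And>i. i < n \<Longrightarrow> T i = {j} \<Longrightarrow> T (Suc i mod n) = {j}"
      by blast
    show thesis
    proof (cases "\<exists>i<n. T i = {j}")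
      case True
      \<comment> \<open>A mark \<open>{j}\<close> is always followed by \<open>{j}\<close>, hence it
        propagates around the whole cycle.\<close>
      then have all: "T i = {j}" if "i < n" for i
        using cyclic_induct[of _ n "\<lambda>i. T i = {j}" i] j that by blast
      have "S p \<subseteq> {j}" if "p < c" for p
      proof (cases "S p = {}")
        case False
        then have "p \<in> set ms" using that set_ms by simp
        then show ?thesis using all by (auto simp: in_set_conv_nth T_def n_def)
      qed simp
      then show thesis using single j by blast
    next
      case False
      \<comment> \<open>No mark equals \<open>{j}\<close>, so every segment starting at a mark that
        contains \<open>j\<close> ends at a mark with another index and is long. Adding these
        disjoint segments gives the \<open>heavy\<close> outcome.\<close>
      let ?I = "{i. i < n \<and> j \<in> T i}"
      have "(!) ms ` ?I = {p \<in> (!) ms ` {..<n}. j \<in> S p}"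
        by (auto simp: T_def)
      also have "\<dots> = {p. p < c \<and> j \<in> S p}"
        unfolding bij_betw_imp_surj_on[OF bij] set_ms by auto
      finally have "bij_betw ((!) ms) ?I {p. p < c \<and> j \<in> S p}"
        using bij by (intro bij_betw_subset[OF bij]) auto
      then have "(h + 1) * card {p. p < c \<and> j \<in> S p} = (\<Sum>i\<in>?I. h + 1)"
        using bij_betw_same_card by fastforce
      also have "\<dots> \<le> (\<Sum>i\<in>?I. g i)"
        using gap_heavy[OF _ j(1)] False suc by (intro sum_mono) fastforce
      also have "\<dots> \<le> (\<Sum>i<n. g i)"
        by (intro sum_mono2) auto
      finally show thesis
        using heavy j sum_g by simp
    qed
  qed
qed

section \<open>A longest cycle and a longest cycle in its complement\<close>

lemma sum_card_swap:
  "(\<Sum>i<n. card {k. k < m \<and> P i k}) = (\<Sum>k<m. card {i. i < n \<and> P i k})" for n m :: nat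
proof -
  have "(\<Sum>i<n. card {k. k < m \<and> P i k}) = (\<Sum>i<n. \<Sum>k<m. of_bool (P i k))"
    by (intro sum.cong) (auto intro!: arg_cong[where f = card])
  also have "\<dots> = (\<Sum>k<m. \<Sum>i<n. of_bool (P i k))"
    by (rule sum.swap)
  also have "\<dots> = (\<Sum>k<m. card {i. i < n \<and> P i k})"
    by (intro sum.cong) (auto intro!: arg_cong[where f = card])
  finally show ?thesis .
qed

lemma (in sgraph) gpath_merge:
  assumes "gpath A xs" "gpath A ys" "last xs = hd ys" "set xs \<inter> set ys \<subseteq> {hd ys}"
  shows "gpath A (xs @ tl ys)" "last (xs @ tl ys) = last ys"
proof -
  obtain y zs where ys: "ys = y # zs"
    using assms(2) by (cases ys) (auto simp: gpath_def)
  show "gpath A (xs @ tl ys)"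
    using assms unfolding ys gpath_def
    by (auto simp: successively_append_iff successively_Cons)
  show "last (xs @ tl ys) = last ys"
    using assms(3) by (auto simp: ys)
qed

locale two_cycles = sgraph E for E :: "'a \<Rightarrow> 'a \<Rightarrow> bool" +
  fixes V :: "'a set" and C H :: "'a list"
  assumes finite_V: "finite V"
    and longest_C: "longest V C"
    and longest_H: "longest (V - set C) H"
begin

abbreviation \<Gamma> :: "'a set" where "\<Gamma> \<equiv> V - set C"
abbreviation h :: nat where "h \<equiv> length H"
abbreviation c :: nat where "c \<equiv> length C"

definition path_system :: "(nat \<Rightarrow> 'a list) \<Rightarrow> bool" where
  "path_system Q \<longleftrightarrow>
     (\<forall>i<h. gpath \<Gamma> (Q i) \<and> hd (Q i) = H ! i \<and> set (Q i) \<inter> set H = {H ! i}) \<and>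
     (\<forall>i<h. \<forall>k<h. i \<noteq> k \<longrightarrow> set (Q i) \<inter> set (Q k) = {})"

text \<open>The bonus for nontrivial paths makes the weight grow also when one path is split into
  two nontrivial ones without gaining vertices.\<close>

definition cost :: "'a list \<Rightarrow> nat" where
  "cost xs = length xs + of_bool (2 \<le> length xs)"

definition weight :: "(nat \<Rightarrow> 'a list) \<Rightarrow> nat" where
  "weight Q = (\<Sum>i<h. cost (Q i))"

lemma weight_update: "i < h \<Longrightarrow> weight (Q(i := xs)) + cost (Q i) = weight Q + cost xs"
  unfolding weight_def by (simp add: sum.remove[of "{..<h}" i])

lemma H_props: "gpath \<Gamma> H" "distinct H" "set H \<subseteq> \<Gamma>" "0 < h"
  using longest_H by (auto simp: longest_def gcycle_def gpath_def)

lemma ex_maximal_path_system: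
  obtains Q where "path_system Q" "\<And>Q'. path_system Q' \<Longrightarrow> weight Q' \<le> weight Q"
proof -
  have "H ! i \<in> \<Gamma>" "H ! i \<in> set H" if "i < h" for i
    using that H_props(3) nth_mem by blast+
  then have "path_system (\<lambda>i. [H ! i])"
    using H_props nth_eq_iff_index_eq[of H] by (auto simp: path_system_def)
  moreover have "weight Q < Suc (h * (card \<Gamma> + 1))" if "path_system Q" for Q
  proof -
    have "cost (Q i) \<le> card \<Gamma> + 1" if "i < h" for i
      using gpath_length_le[of \<Gamma> "Q i"] finite_V \<open>path_system Q\<close> that
      by (auto simp: path_system_def cost_def)
    then show ?thesis
      using sum_bounded_above[of "{..<h}" "\<lambda>i. cost (Q i)" "card \<Gamma> + 1"]
      by (simp add: weight_def)
  qed
  ultimately show ?thesis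
    using that ex_has_greatest_nat[of path_system "\<lambda>i. [H ! i]" weight "Suc (h * (card \<Gamma> + 1))"]
    by blast
qed

text \<open>Otherwise \<open>v\<close> could be inserted into H. For h = 1 the two positions
  coincide and the longer cycle is a single edge.\<close>

lemma no_consecutive_nbrs:
  assumes "v \<in> \<Gamma>" "v \<notin> set H" "i < h" "E (H ! i) v"
  shows "\<not> E (H ! (Suc i mod h)) v"
proof
  assume "E (H ! (Suc i mod h)) v"
  then have "length [v] + 1 \<le> fwd h i (Suc i mod h)"
    using assms H_props by (intro longest_detour[OF longest_H]) (auto intro: sym)
  then show False
    using fwd_Suc_mod[of i h] assms by simp
qed

text \<open>The legs \<open>X\<close> and reversed \<open>Y\<close>, glued at their common end, form
  a detour of H with one vertex fewer than both legs have together.\<close>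

lemma legs_length_le:
  assumes "k < h" "l < h"
    and "gpath (\<Gamma> - set H) X" "E (H ! k) (hd X)" "gpath (\<Gamma> - set H) Y" "E (H ! l) (hd Y)"
    and "last X = last Y" "set X \<inter> set (butlast Y) = {}"
  shows "length X + length Y \<le> fwd h k l"
proof -
  let ?P = "X @ tl (rev Y)"
  have ne: "X \<noteq> []" "Y \<noteq> []"
    using assms by (auto simp: gpath_def)
  have Y: "set Y = insert (last Y) (set (butlast Y))"
    using ne append_butlast_last_id[of Y] by (metis list.set(2) rotate1.simps(2) set_rotate1)
  have m: "gpath (\<Gamma> - set H) ?P" "last ?P = last (rev Y)"
    using assms ne Y by (intro gpath_merge gpath_rev; auto simp: hd_rev)+
  have "length ?P + 1 \<le> fwd h k l"
  proof (rule longest_detour[OF longest_H])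
    show "gpath \<Gamma> ?P" using m gpath_mono by blast
    show "set ?P \<inter> set H = {}" using m by (auto simp: gpath_def)
    show "E (H ! k) (hd ?P)" "E (last ?P) (H ! l)"
      using assms ne m by (auto simp: last_rev intro: sym)
  qed (use assms in auto)
  moreover have "0 < length Y" using ne by simp
  ultimately show ?thesis by simp
qed

end

section \<open>Maximal path systems\<close>

locale maximal_path_system = two_cycles +
  fixes Q :: "nat \<Rightarrow> 'a list"
  assumes path_system: "path_system Q"
    and weight_max: "path_system Q' \<Longrightarrow> weight Q' \<le> weight Q"
begin

definition w :: "nat \<Rightarrow> 'a" where "w i = last (Q i)"
definition q :: "nat \<Rightarrow> nat" where "q i = length (Q i) - 1"
definition d :: "nat \<Rightarrow> nat" where "d i = card (nbrs \<Gamma> (w i))"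
text \<open>For a nontrivial path, \<open>Q k ! 1\<close> is its first vertex off H. These numbers
  measure how far the ends of trivial paths may exceed h - 1 neighbours.\<close>

definition r :: "nat \<Rightarrow> nat" where "r k = card {i. i < h \<and> q i = 0 \<and> E (H ! i) (Q k ! 1)}"

lemma Q_props:
  assumes "i < h"
  shows "gpath \<Gamma> (Q i)" "hd (Q i) = H ! i" "set (Q i) \<inter> set H = {H ! i}" "Q i \<noteq> []"
    "distinct (Q i)" "set (Q i) \<subseteq> \<Gamma>" "w i \<in> set (Q i)" "Q i ! 0 = H ! i" "length (Q i) = Suc (q i)"
  using assms path_system
  by (auto simp: path_system_def gpath_def w_def q_def hd_conv_nth)

lemma in_set_Q: "k < h \<Longrightarrow> x \<in> set (Q k) \<longleftrightarrow> (\<exists>t\<le>q k. x = Q k ! t)"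
  using Q_props(9)[of k] by (auto simp: in_set_conv_nth less_Suc_eq_le)

lemma Q_disjoint: "i < h \<Longrightarrow> k < h \<Longrightarrow> i \<noteq> k \<Longrightarrow> set (Q i) \<inter> set (Q k) = {}"
  using path_system by (auto simp: path_system_def)

lemma Q_nth_notin_H:
  assumes "k < h" "0 < t" "t \<le> q k" shows "Q k ! t \<notin> set H" "Q k ! t \<in> \<Gamma>"
proof -
  have "Q k ! t \<in> set (Q k)" "Q k ! t \<noteq> Q k ! 0"
    using assms Q_props[of k] nth_eq_iff_index_eq[of "Q k" t 0] by auto
  then show "Q k ! t \<notin> set H" "Q k ! t \<in> \<Gamma>"
    using Q_props[OF assms(1)] by auto
qed

lemma w_trivial: "i < h \<Longrightarrow> q i = 0 \<Longrightarrow> w i = H ! i"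
  using Q_props[of i] by (cases "Q i") (auto simp: w_def)

text \<open>An uncovered neighbour could be appended to path \<open>i\<close>, which would raise the
  weight.\<close>

lemma end_nbrs_covered:
  assumes "i < h" "x \<in> nbrs \<Gamma> (w i)"
  shows "\<exists>k<h. x \<in> set (Q k)"
proof (rule ccontr)
  assume *: "\<not> ?thesis"
  let ?Q = "Q(i := Q i @ [x])"
  have x: "x \<in> \<Gamma>" "E (w i) x"
    using assms by (auto simp: nbrs_def)
  have "x \<notin> set H"
  proof
    assume "x \<in> set H"
    then obtain k where "k < h" "x = H ! k" by (auto simp: in_set_conv_nth)
    then show False using * Q_props[of k] hd_in_set by metis
  qed
  moreover have "gpath \<Gamma> (Q i @ [x])"
    using x * assms Q_props[of i] by (intro gpath_append) (auto simp: w_def)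
  ultimately have "path_system ?Q"
    using path_system * assms Q_props[of i] by (auto simp: path_system_def)
  then have "weight ?Q \<le> weight Q" by (rule weight_max)
  then show False
    using weight_update[OF assms(1), of Q "Q i @ [x]"]
      Q_props(4)[OF assms(1)]
    by (cases "Q i") (auto simp: cost_def of_bool_def split: if_splits)
qed

text \<open>Otherwise the final part of path \<open>k\<close> could be handed over to the trivial path \<open>i\<close>, which
  creates an additional nontrivial path without losing vertices.\<close>

lemma trivial_nbr_index:
  assumes "i < h" "q i = 0" "k < h" "t \<le> q k" "E (H ! i) (Q k ! t)"
  shows "t \<le> 1"
proof (rule ccontr)
  assume "\<not> t \<le> 1"
  then have t: "2 \<le> t" "t < length (Q k)"
    using assms Q_props[of k] by auto
  then have "i \<noteq> k"
    using assms by auto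
  define xs where "xs = H ! i # drop t (Q k)"
  define ys where "ys = take t (Q k)"
  let ?Q = "(Q(i := xs))(k := ys)"
  note Qi = Q_props[OF assms(1)] and Qk = Q_props[OF assms(3)]
  have Hi: "H ! i \<notin> set (Q k)"
    using Q_disjoint[OF assms(1,3) \<open>i \<noteq> k\<close>] Qi hd_in_set by (metis disjoint_iff)
  have sub: "set (take t (Q k)) \<subseteq> set (Q k)" "set (drop t (Q k)) \<subseteq> set (Q k)"
    by (auto dest: in_set_takeD in_set_dropD)
  have disj: "set (take t (Q k)) \<inter> set (drop t (Q k)) = {}"
    using set_take_disj_set_drop_if_distinct[of "Q k" t t] Qk by simp
  have head: "hd ys = H ! k" "H ! k \<in> set ys" "hd xs = H ! i"
    using t Qk hd_in_set[of "take t (Q k)"] by (auto simp: xs_def ys_def)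
  have "H ! i \<in> \<Gamma>"
    using Qi hd_in_set[of "Q i"] by auto
  then have "gpath \<Gamma> ([H ! i] @ drop t (Q k))"
    using Qk t Hi sub assms by (intro gpath_append gpath_drop) (auto simp: hd_drop_conv_nth)
  then have p: "gpath \<Gamma> xs" by (simp add: xs_def)
  have p': "gpath \<Gamma> ys"
    using Qk t unfolding ys_def by (intro gpath_take) auto
  have "set (drop t (Q k)) \<inter> set H \<subseteq> {H ! k}"
    using sub(2) Qk(3) by blast
  moreover have "H ! k \<notin> set (drop t (Q k))"
    using disj head(2) by (auto simp: ys_def)
  ultimately have "set (drop t (Q k)) \<inter> set H = {}"
    by blast
  then have HQ: "set xs \<inter> set H = {H ! i}" "set ys \<inter> set H = {H ! k}"
    using sub(1) head(2) Qk(3) nth_mem[OF assms(1)] nth_mem[OF assms(3)] unfolding xs_def ys_def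
    by auto
  have D: "set (Q m) \<inter> set xs = {}" "set (Q m) \<inter> set ys = {}"
    if "m < h" "m \<noteq> i" "m \<noteq> k" for m
    using that sub Q_disjoint[OF that(1) assms(1)] Q_disjoint[OF that(1) assms(3)] Qi(2,4)
      hd_in_set[of "Q i"] unfolding xs_def ys_def by auto
  have D': "set xs \<inter> set ys = {}"
    using Hi sub disj unfolding xs_def ys_def by auto
  have "gpath \<Gamma> (?Q m) \<and> hd (?Q m) = H ! m \<and> set (?Q m) \<inter> set H = {H ! m}" if "m < h" for m
    using p p' HQ head Q_props(1-3)[OF that] by auto
  moreover have "set (?Q m) \<inter> set (?Q m') = {}" if "m < h" "m' < h" "m \<noteq> m'" for m m'
    using D[OF that(1)] D[OF that(2)] D' Q_disjoint[OF that] that(3)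
    by (simp add: Int_commute)
  ultimately have "path_system ?Q"
    unfolding path_system_def by blast
  then have "weight ?Q \<le> weight Q" by (rule weight_max)
  \<comment> \<open>The exchange keeps the total number of vertices. As 2 \<le> t, \<open>ys\<close>
    stays nontrivial, and \<open>xs\<close> becomes nontrivial, so the bonus increases by
    one.\<close>
  moreover have "weight ?Q + cost (Q k) + cost (Q i) = weight Q + cost xs + cost ys"
    using weight_update[OF assms(3), of "Q(i := xs)" ys] \<open>i \<noteq> k\<close>
      weight_update[OF assms(1), of Q xs] by simp
  ultimately show False
    using t Qi Qk assms by (simp add: cost_def xs_def ys_def)
qed

end

section \<open>Degrees of the path ends in the complement of C\<close>

context maximal_path_system
begin

text \<open>The vertex \<open>Q k ! 1\<close> is adjacent to \<open>H ! k\<close> as well as to the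
  vertices counted by \<open>r k\<close>, and no two of these are consecutive on H.\<close>

lemma two_r_le:
  assumes "k < h" "0 < q k" shows "2 * r k + 2 \<le> h"
proof -
  let ?R = "{i. i < h \<and> q i = 0 \<and> E (H ! i) (Q k ! 1)}"
  have v: "Q k ! 1 \<in> \<Gamma>" "Q k ! 1 \<notin> set H"
    using Q_nth_notin_H[of k 1] assms by auto
  have "E (Q k ! 0) (Q k ! 1)"
    using gpath_nth_Suc[of \<Gamma> "Q k" 0] Q_props[of k] assms by simp
  then have "E (H ! i) (Q k ! 1)" if "i \<in> insert k ?R" for i
    using that Q_props[of k] assms by auto
  then have "card (insert k ?R) + card (insert k ?R) \<le> h"
    using no_consecutive_nbrs[OF v] assms by (intro card_add_card_le_cyclic) auto
  then show ?thesis
    using assms by (simp add: r_def)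
qed

text \<open>By \<open>trivial_nbr_index\<close> the neighbours of a trivial end are first or second
  vertices of paths: at most h - 1 of them lie on H, the others are vertices
  \<open>Q k ! 1\<close>.\<close>

lemma d_trivial:
  assumes "i < h" "q i = 0"
  shows "d i + 1 \<le> h + card {k. k < h \<and> 0 < q k \<and> E (H ! i) (Q k ! 1)}"
proof -
  let ?K = "{k. k < h \<and> 0 < q k \<and> E (H ! i) (Q k ! 1)}"
  have "nbrs \<Gamma> (w i) \<subseteq> (set H - {H ! i}) \<union> (\<lambda>k. Q k ! 1) ` ?K"
  proof
    fix x assume x: "x \<in> nbrs \<Gamma> (w i)"
    then obtain k where k: "k < h" "x \<in> set (Q k)"
      using end_nbrs_covered assms by blast
    then obtain t where t: "t \<le> q k" "x = Q k ! t"
      using in_set_Q by blast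
    have e: "E (H ! i) x"
      using x w_trivial[OF assms] by (simp add: nbrs_def)
    then have "t \<le> 1"
      using trivial_nbr_index[OF assms k(1) t(1)] t by simp
    then show "x \<in> (set H - {H ! i}) \<union> (\<lambda>k. Q k ! 1) ` ?K"
      using k t e irrefl Q_props[of k] by (cases "t = 0") (auto simp: le_Suc_eq)
  qed
  then have "d i \<le> card ((set H - {H ! i}) \<union> (\<lambda>k. Q k ! 1) ` ?K)"
    unfolding d_def by (intro card_mono) auto
  also have "\<dots> \<le> card (set H - {H ! i}) + card ?K"
    using card_Un_le[of "set H - {H ! i}" "(\<lambda>k. Q k ! 1) ` ?K"] card_image_le[of ?K "\<lambda>k. Q k ! 1"]
    by simp
  finally show ?thesis
    using H_props assms by (simp add: distinct_card)
qed

text \<open>For \<open>k = j\<close> the leg is path \<open>j\<close> without its foot on H.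
  Otherwise it follows path \<open>k\<close> beyond its foot up to the last neighbour of
  \<open>w j\<close> and then steps to \<open>w j\<close>; having \<open>w j\<close> in place of the
  foot keeps it as long as the number of neighbours.\<close>

lemma ex_leg:
  assumes "j < h" "0 < q j" "k < h" "k = j \<or> nbrs \<Gamma> (w j) \<inter> set (Q k) \<noteq> {}"
  shows "\<exists>X. gpath (\<Gamma> - set H) X \<and> E (H ! k) (hd X) \<and> last X = w j \<and>
    set (butlast X) \<subseteq> set (Q k) - {w j} \<and> card (nbrs \<Gamma> (w j) \<inter> set (Q k)) \<le> length X"
proof (cases "k = j")
  case True
  note Qj = Q_props[OF assms(1)]
  define ys where "ys = tl (Q j)"
  have ys: "Q j = H ! j # ys" "ys \<noteq> []"
    using Qj(2,4,9) assms(2) unfolding ys_def by (cases "Q j"; auto)+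
  have w: "last ys = w j"
    using ys by (simp add: w_def)
  then have "ys = butlast ys @ [w j]"
    using ys by (metis append_butlast_last_id)
  then have "distinct (butlast ys @ [w j])"
    using Qj(5) ys(1) by (metis distinct.simps(2))
  then have "set (butlast ys) \<subseteq> set (Q j) - {w j}"
    using ys by (auto dest: in_set_butlastD)
  moreover have "set ys \<inter> set H \<subseteq> {H ! j}"
    using Qj(3) ys(1) by (metis Int_mono set_subset_Cons subset_refl)
  then have "gpath (\<Gamma> - set H) ys" "E (H ! j) (hd ys)"
    using Qj(1,5,6) ys by (auto simp: gpath_def successively_Cons)
  moreover have "card (nbrs \<Gamma> (w j) \<inter> set (Q j)) \<le> card (set (Q j) - {w j})"
    by (intro card_mono) (auto simp: nbrs_def irrefl)
  moreover have "card (set (Q j) - {w j}) = length ys"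
    using Qj ys by (simp add: distinct_card)
  ultimately show ?thesis
    using True w by auto
next
  case False
  note Qk = Q_props[OF assms(3)]
  define A where "A = {t. t \<le> q k \<and> E (w j) (Q k ! t)}"
  have "finite A" by (simp add: A_def)
  moreover have "A \<noteq> {}"
    using assms(4) False in_set_Q[OF assms(3)] by (auto simp: A_def nbrs_def)
  ultimately have a: "Max A \<in> A" "\<And>t. t \<in> A \<Longrightarrow> t \<le> Max A"
    by auto
  define a where "a = Max A"
  define zs where "zs = tl (take (Suc a) (Q k))"
  let ?X = "zs @ [w j]"
  have aq: "a \<le> q k" "E (w j) (Q k ! a)"
    using a by (auto simp: A_def a_def)
  have w: "w j \<notin> set (Q k)" "w j \<in> \<Gamma>"
    using Q_props[OF assms(1)] Q_disjoint[OF assms(1,3)] False by auto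
  have "w j = Q j ! q j"
    using Q_props[OF assms(1)] by (simp add: w_def last_conv_nth)
  then have wH: "w j \<notin> set H"
    using Q_nth_notin_H[OF assms(1,2)] by simp
  have zs: "take (Suc a) (Q k) = H ! k # zs"
    using Qk(2,4) by (cases "Q k") (auto simp: zs_def)
  have g: "gpath \<Gamma> (H ! k # zs)"
    using gpath_take[OF Qk(1), of "Suc a"] zs by simp
  have l: "last (H ! k # zs) = Q k ! a"
    using aq Qk(9) unfolding zs[symmetric] by (simp add: take_Suc_conv_app_nth)
  have sub: "set (H ! k # zs) \<subseteq> set (Q k)"
    unfolding zs[symmetric] by (rule set_take_subset)
  have wz: "w j \<notin> set zs"
    using w(1) sub by auto
  have "set zs \<inter> set H \<subseteq> {H ! k}"
    using sub Qk(3) by auto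
  then have zH: "set zs \<inter> set H = {}"
    using g by (auto simp: gpath_def)
  have "gpath (\<Gamma> - set H) ?X \<and> E (H ! k) (hd ?X)"
  proof (cases "zs = []")
    case True
    then have "E (w j) (H ! k)" using l aq by simp
    then show ?thesis using True w wH by (auto intro: sym)
  next
    case False
    then have z: "set zs \<subseteq> \<Gamma> - set H" "successively E zs" "distinct zs" "E (H ! k) (hd zs)"
      "last zs = Q k ! a"
      using g l zH by (auto simp: gpath_def successively_Cons)
    then have "gpath (\<Gamma> - set H) zs"
      using False by (simp add: gpath_def)
    moreover have "E (last zs) (w j)"
      using z(5) aq(2) sym by simp
    ultimately have "gpath (\<Gamma> - set H) ?X"
      using w wH wz by (intro gpath_append) auto
    then show ?thesis using z(4) False by simp
  qed
  moreover have "set zs \<subseteq> set (Q k) - {w j}"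
    using sub wz by auto
  moreover have "nbrs \<Gamma> (w j) \<inter> set (Q k) \<subseteq> set (take (Suc a) (Q k))"
  proof
    fix x assume "x \<in> nbrs \<Gamma> (w j) \<inter> set (Q k)"
    then obtain t where t: "t \<le> q k" "x = Q k ! t" "E (w j) x"
      using in_set_Q[OF assms(3)] by (auto simp: nbrs_def)
    then have "t \<le> a"
      using a by (simp add: A_def a_def)
    then show "x \<in> set (take (Suc a) (Q k))"
      using nth_mem[of t "take (Suc a) (Q k)"] t aq Qk(9) by simp
  qed
  then have "card (nbrs \<Gamma> (w j) \<inter> set (Q k)) \<le> card (set (take (Suc a) (Q k)))"
    by (intro card_mono) auto
  then have "card (nbrs \<Gamma> (w j) \<inter> set (Q k)) \<le> length ?X"
    using aq Qk by (simp add: distinct_card zs_def)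
  ultimately show ?thesis
    by (intro exI[of _ ?X]) simp
qed

text \<open>The first neighbour of \<open>w j\<close> on path \<open>j\<close> closes a cycle
  through \<open>w j\<close> and all its neighbours.\<close>

lemma d_nontrivial_own_path:
  assumes "j < h" "0 < q j" "nbrs \<Gamma> (w j) \<subseteq> set (Q j)"
  shows "d j + 1 \<le> h" "d j \<le> q j"
proof -
  note Qj = Q_props[OF assms(1)]
  have wj: "w j = Q j ! q j"
    using Qj by (simp add: w_def last_conv_nth)
  define A where "A = {t. t < q j \<and> E (w j) (Q j ! t)}"
  have "nbrs \<Gamma> (w j) \<subseteq> (!) (Q j) ` A"
  proof
    fix x assume x: "x \<in> nbrs \<Gamma> (w j)"
    then obtain t where t: "t \<le> q j" "x = Q j ! t"
      using assms(3) in_set_Q[OF assms(1)] by blast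
    moreover have "t \<noteq> q j"
      using x t wj irrefl by (auto simp: nbrs_def)
    ultimately show "x \<in> (!) (Q j) ` A"
      using x by (auto simp: A_def nbrs_def)
  qed
  then have dA: "d j \<le> card A"
    unfolding d_def by (rule surj_card_le[rotated]) (simp add: A_def)
  have "card A \<le> card {..<q j}"
    by (intro card_mono) (auto simp: A_def)
  then show "d j \<le> q j" using dA by simp
  show "d j + 1 \<le> h"
  proof (cases "A = {}")
    case True
    then show ?thesis using dA H_props(4) by (simp add: Suc_le_eq)
  next
    case False
    define t where "t = Min A"
    have "finite A" by (simp add: A_def)
    then have "t \<in> A" and le: "\<And>s. s \<in> A \<Longrightarrow> t \<le> s"
      using False unfolding t_def by auto
    moreover have "A \<subseteq> {t..<q j}"
      using le by (auto simp: A_def)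
    ultimately have t: "t \<in> A" "A \<subseteq> {t..<q j}" by auto
    then have tq: "t < q j" "E (w j) (Q j ! t)"
      by (auto simp: A_def)
    then have "gcycle \<Gamma> (drop t (Q j))"
      using gpath_drop[OF Qj(1), of t] Qj(9) by (simp add: gcycle_def w_def hd_drop_conv_nth)
    then have "length (drop t (Q j)) \<le> h"
      using longest_H unfolding longest_def by blast
    moreover have "card A \<le> q j - t"
      using card_mono[OF _ t(2)] by simp
    ultimately show ?thesis
      using tq dA Qj(9) by simp
  qed
qed

text \<open>Join \<open>w j\<close> to \<open>H\<close> by one leg through each path that contains neighbours of \<open>w j\<close>. Two legs
  together are at most as long as either arc of \<open>H\<close> between their feet, so if there are at least
  two of them then their total length is at most \<open>h / 2\<close>.\<close>

lemma d_nontrivial: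
  assumes "j < h" "0 < q j"
  shows "d j + 1 \<le> h \<and> (2 * d j \<le> h \<or> d j \<le> q j)"
proof -
  define K where "K = {k. k < h \<and> (k = j \<or> nbrs \<Gamma> (w j) \<inter> set (Q k) \<noteq> {})}"
  have K: "finite K" "j \<in> K" "K \<subseteq> {..<h}"
    using assms by (auto simp: K_def)
  show ?thesis
  proof (cases "K = {j}")
    case True
    have "nbrs \<Gamma> (w j) \<subseteq> set (Q j)"
    proof
      fix x assume x: "x \<in> nbrs \<Gamma> (w j)"
      then obtain k where "k < h" "x \<in> set (Q k)"
        using end_nbrs_covered assms by blast
      then have "k \<in> K" using x by (auto simp: K_def)
      then show "x \<in> set (Q j)" using True \<open>x \<in> set (Q k)\<close> by simp
    qed
    then show ?thesis
      using d_nontrivial_own_path assms by blast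
  next
    case False
    have "\<forall>k\<in>K. \<exists>X. gpath (\<Gamma> - set H) X \<and> E (H ! k) (hd X) \<and> last X = w j \<and>
        set (butlast X) \<subseteq> set (Q k) - {w j} \<and> card (nbrs \<Gamma> (w j) \<inter> set (Q k)) \<le> length X"
      using ex_leg[OF assms] by (auto simp: K_def)
    then obtain X where X: "\<And>k. k \<in> K \<Longrightarrow> gpath (\<Gamma> - set H) (X k) \<and> E (H ! k) (hd (X k)) \<and>
        last (X k) = w j \<and> set (butlast (X k)) \<subseteq> set (Q k) - {w j} \<and>
        card (nbrs \<Gamma> (w j) \<inter> set (Q k)) \<le> length (X k)"
      by metis
    have pair: "length (X k) + length (X l) \<le> fwd h k l" if "k \<in> K" "l \<in> K" "k \<noteq> l" for k l
    proof (rule legs_length_le)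
      have "X k \<noteq> []"
        using X[OF that(1)] by (auto simp: gpath_def)
      then have "X k = butlast (X k) @ [w j]"
        using X[OF that(1)] by (metis append_butlast_last_id)
      then have "set (X k) = insert (w j) (set (butlast (X k)))"
        by (metis list.set(2) rotate1.simps(2) set_rotate1)
      then have "set (X k) \<subseteq> insert (w j) (set (Q k))"
        using X[OF that(1)] by auto
      moreover have "set (Q k) \<inter> set (Q l) = {}"
        using that K by (intro Q_disjoint) auto
      ultimately show "set (X k) \<inter> set (butlast (X l)) = {}"
        using X[OF that(2)] by auto
    qed (use X that K in auto)
    have "2 * (\<Sum>k\<in>K. length (X k)) \<le> Max K - Min K + length (X (Min K)) + length (X (Max K))"
    proof (rule double_sum_le_spread)
      show "length (X k) + length (X l) \<le> l - k" if "k \<in> K" "l \<in> K" "k < l" for k l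
        using pair[of k l] that by (simp add: fwd_def)
    qed (use K in auto)
    moreover have MK: "Max K \<in> K" "Min K \<in> K" "Min K \<noteq> Max K"
    proof -
      have "K \<noteq> {}" using K by auto
      then show "Max K \<in> K" "Min K \<in> K" using K by simp_all
      obtain k where "k \<in> K" "k \<noteq> j" using False K by blast
      then show "Min K \<noteq> Max K"
        using K by (metis Max_ge Min_le le_antisym)
    qed
    moreover have "Min K < Max K"
      using MK(3) Min_le[OF K(1) MK(1)] by (rule order_neq_le_trans)
    moreover have "Max K < h"
      using MK(1) K(3) by blast
    \<comment> \<open>The legs at the two extreme feet are bounded by the arc that wraps around from
      \<open>Max K\<close> to \<open>Min K\<close>.\<close>
    ultimately have "2 * (\<Sum>k\<in>K. length (X k)) \<le> h"
      using pair[OF MK(1,2)] by (simp add: fwd_def)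
    moreover have "d j \<le> (\<Sum>k\<in>K. length (X k))"
    proof -
      have "nbrs \<Gamma> (w j) \<subseteq> (\<Union>k\<in>K. nbrs \<Gamma> (w j) \<inter> set (Q k))"
        using end_nbrs_covered[OF assms(1)] unfolding K_def by blast
      then have "d j \<le> card (\<Union>k\<in>K. nbrs \<Gamma> (w j) \<inter> set (Q k))"
        unfolding d_def using K by (intro card_mono) auto
      also have "\<dots> \<le> (\<Sum>k\<in>K. card (nbrs \<Gamma> (w j) \<inter> set (Q k)))"
        by (rule card_UN_le) (use K in auto)
      also have "\<dots> \<le> (\<Sum>k\<in>K. length (X k))"
        using X by (intro sum_mono) auto
      finally show ?thesis .
    qed
    ultimately show ?thesis
      using \<open>Min K < Max K\<close> \<open>Max K < h\<close> by linarith
  qed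
qed

end

section \<open>The length of the longest cycle\<close>

context maximal_path_system
begin

text \<open>Among the nontrivial paths, only these can have an end with more than h/2 neighbours in
  \<open>\<Gamma>\<close>.\<close>

definition B :: "nat set" where "B = {k. k < h \<and> 0 < q k \<and> h + 1 \<le> 2 * q k}"

text \<open>Double counting the excess of trivial ends gives the sum of \<open>r k\<close> over all
  nontrivial \<open>k\<close>. A nontrivial path outside \<open>B\<close> satisfies
  \<open>d k + r k \<le> h - 1\<close> and thus pays for its own \<open>r k\<close>; only the terms
  from \<open>B\<close> remain.\<close>

lemma sum_d: "(\<Sum>i<h. d i) \<le> h * (h - 1) + (\<Sum>k\<in>B. r k)"
proof -
  define b where "b k = (if k \<in> B then r k else 0)" for k
  have "0 < h" by (rule H_props)
  have "d i + (if 0 < q i then r i else 0) \<le>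
      (h - 1) + card {k. k < h \<and> q i = 0 \<and> 0 < q k \<and> E (H ! i) (Q k ! 1)} + b i" if "i < h" for i
  proof (cases "q i = 0")
    case True
    then show ?thesis using d_trivial[OF that True] by simp
  next
    case False
    then have "2 * r i + 2 \<le> h" "d i + 1 \<le> h" "2 * d i \<le> h \<or> d i \<le> q i"
      using d_nontrivial[OF that] two_r_le[OF that] by auto
    then show ?thesis
      using False that by (auto simp: b_def B_def)
  qed
  then have "(\<Sum>i<h. d i + (if 0 < q i then r i else 0)) \<le>
      (\<Sum>i<h. (h - 1) + card {k. k < h \<and> q i = 0 \<and> 0 < q k \<and> E (H ! i) (Q k ! 1)} + b i)"
    by (intro sum_mono) auto
  also have "\<dots> = h * (h - 1) +
      (\<Sum>k<h. card {i. i < h \<and> q i = 0 \<and> 0 < q k \<and> E (H ! i) (Q k ! 1)}) + (\<Sum>i<h. b i)"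
    unfolding sum.distrib by (subst sum_card_swap) simp
  also have "(\<Sum>k<h. card {i. i < h \<and> q i = 0 \<and> 0 < q k \<and> E (H ! i) (Q k ! 1)}) =
      (\<Sum>k<h. if 0 < q k then r k else 0)"
    by (intro sum.cong) (auto simp: r_def)
  also have "(\<Sum>i<h. b i) = (\<Sum>k\<in>B. r k)"
    unfolding b_def by (intro sum.mono_neutral_cong_right) (auto simp: B_def)
  finally show ?thesis
    by (simp add: sum.distrib)
qed

text \<open>Go down path \<open>i\<close>, along H forward from \<open>i\<close> to
  \<open>k\<close>, and up path \<open>k\<close>.\<close>

lemma ex_connecting_path:
  assumes "i < h" "k < h" "i \<noteq> k"
  obtains P where "gpath \<Gamma> P" "hd P = w i" "last P = w k" "length P = q i + q k + fwd h i k + 1"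
proof -
  note Qi = Q_props[OF assms(1)] and Qk = Q_props[OF assms(2)]
  obtain A where A: "gpath \<Gamma> A" "hd A = H ! i" "last A = H ! k" "set A \<subseteq> set H"
    "length A + fwd h k i = h + 1"
    using cycle_arc[of \<Gamma> H k i] longest_H assms unfolding longest_def by metis
  have lenA: "length A = fwd h i k + 1"
    using A(5) fwd_add_fwd[OF assms] by simp
  have "A \<noteq> []" using A(1) by (simp add: gpath_def)
  let ?R = "rev (Q i) @ tl A"
  have R: "gpath \<Gamma> ?R" "last ?R = H ! k"
  proof -
    have "last (rev (Q i)) = hd A" "set (rev (Q i)) \<inter> set A \<subseteq> {hd A}"
      using Qi A by (auto simp: last_rev)
    with gpath_merge[OF gpath_rev[OF Qi(1)] A(1)] A(3)
    show "gpath \<Gamma> ?R" "last ?R = H ! k" by auto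
  qed
  have "set H \<inter> set (Q k) = {hd (Q k)}"
    unfolding Qk(2) using Qk(3) by (simp only: Int_commute)
  have "set (tl A) \<subseteq> set H"
    using A(4) by (cases A) auto
  moreover have "set ?R = set (Q i) \<union> set (tl A)" by simp
  ultimately have "set ?R \<inter> set (Q k) \<subseteq> {hd (Q k)}"
    using \<open>set H \<inter> set (Q k) = {hd (Q k)}\<close> Q_disjoint[OF assms] by blast
  moreover have "last ?R = hd (Q k)"
    using R(2) Qk(2) by simp
  ultimately have "gpath \<Gamma> (?R @ tl (Q k))" "last (?R @ tl (Q k)) = w k"
    using gpath_merge[OF R(1) Qk(1)] unfolding w_def by blast+
  moreover have "hd (?R @ tl (Q k)) = w i"
    using Qi(4) unfolding w_def by (simp add: hd_rev)
  moreover have "length (?R @ tl (Q k)) = q i + q k + fwd h i k + 1"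
    using Qi(9) Qk(9) lenA by simp
  ultimately show ?thesis using that by blast
qed

lemma card_nbrs_le: "i < h \<Longrightarrow> card (nbrs V (w i)) \<le> d i + card {p. p < c \<and> E (w i) (C ! p)}"
proof -
  have "nbrs V (w i) \<subseteq> nbrs \<Gamma> (w i) \<union> (!) C ` {p. p < c \<and> E (w i) (C ! p)}"
    by (auto simp: nbrs_def in_set_conv_nth)
  moreover have "finite (nbrs \<Gamma> (w i))"
    using finite_V by (simp add: nbrs_def)
  ultimately have "card (nbrs V (w i)) \<le> card (nbrs \<Gamma> (w i) \<union> (!) C ` {p. p < c \<and> E (w i) (C ! p)})"
    by (intro card_mono) auto
  also have "\<dots> \<le> d i + card ((!) C ` {p. p < c \<and> E (w i) (C ! p)})"
    unfolding d_def by (rule card_Un_le)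
  also have "\<dots> \<le> d i + card {p. p < c \<and> E (w i) (C ! p)}"
    by (intro add_left_mono card_image_le) simp
  finally show ?thesis .
qed

text \<open>Both arcs of H can be used to connect the two ends, each giving a detour of C.\<close>

lemma gap_diff:
  assumes "p < c" "p' < c" "i < h" "k < h" "i \<noteq> k" "E (w i) (C ! p)" "E (w k) (C ! p')"
  shows "q i + q k + fwd h i k + 2 \<le> fwd c p p' \<and> q i + q k + fwd h k i + 2 \<le> fwd c p p'"
proof -
  have *: "length P + 1 \<le> fwd c p p'" if "gpath \<Gamma> P" "hd P = w i" "last P = w k" for P
    using assms that gpath_mono[OF that(1), of V]
    by (intro longest_detour[OF longest_C]) (auto simp: gpath_def intro: sym)
  obtain P where P: "gpath \<Gamma> P" "hd P = w i" "last P = w k" "length P = q i + q k + fwd h i k + 1"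
    using ex_connecting_path assms(3-5) by blast
  obtain P' where P': "gpath \<Gamma> P'" "hd P' = w k" "last P' = w i" "length P' = q k + q i + fwd h k i + 1"
    using ex_connecting_path assms(3-5) by blast
  have "P' \<noteq> []" using P'(1) by (simp add: gpath_def)
  then show ?thesis
    using *[OF P(1-3)] P(4) *[of "rev P'"] gpath_rev[OF P'(1)] P'(2-4)
    by (simp add: hd_rev last_rev)
qed

lemma gap_same:
  assumes "p < c" "p' < c" "i < h" "E (w i) (C ! p)" "E (w i) (C ! p')"
  shows "2 \<le> fwd c p p'"
proof -
  have "w i \<in> \<Gamma>"
    using Q_props[OF assms(3)] by auto
  then have "length [w i] + 1 \<le> fwd c p p'"
    using assms by (intro longest_detour[OF longest_C]) (auto intro: sym)
  then show ?thesis by simp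
qed

theorem length_longest_cycle_ge_maximal:
  assumes deg: "\<And>v. v \<in> V \<Longrightarrow> \<delta> \<le> card (nbrs V v)"
  shows "(h + 1) * (\<delta> + 1 - h) \<le> c"
proof (cases "h \<le> \<delta>")
  case False
  then show ?thesis by simp
next
  case True
  define S where "S p = {i. i < h \<and> E (w i) (C ! p)}" for p
  define m where "m i = card {p. p < c \<and> E (w i) (C ! p)}" for i
  have "0 < h" by (rule H_props)
  have dm: "\<delta> \<le> d i + m i" if "i < h" for i
  proof -
    have "w i \<in> V" using Q_props[OF that] by auto
    then show ?thesis
      using deg[of "w i"] card_nbrs_le[OF that] by (simp add: m_def)
  qed
  have sum_m: "(\<Sum>p<c. card (S p)) = (\<Sum>i<h. m i)"
    unfolding S_def m_def by (rule sum_card_swap[symmetric])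
  have "(\<Sum>i<h. \<delta>) \<le> (\<Sum>i<h. d i + m i)"
    using dm by (intro sum_mono) auto
  then have hd: "h * \<delta> \<le> h * (h - 1) + (\<Sum>k\<in>B. r k) + (\<Sum>i<h. m i)"
    using sum_d by (simp add: sum.distrib)
  have enough: "h * (\<delta> + 1 - h) \<le> (\<Sum>i<h. m i) + (\<Sum>k\<in>B. r k)"
  proof -
    obtain e h' where "\<delta> = h + e" "h = Suc h'"
      using True \<open>0 < h\<close> by (metis le_iff_add gr0_implies_Suc)
    then show ?thesis
      using hd by (simp add: algebra_simps)
  qed
  have Bm: "\<delta> + 1 - h \<le> m j" "0 < m j" if "j \<in> B" for j
    using that dm[of j] d_nontrivial[of j] True by (auto simp: B_def)
  \<comment> \<open>The count along C needs at least one marked position.\<close>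
  have "\<exists>i<h. 0 < m i"
  proof (cases "B = {}")
    case True
    have "0 < h * (\<delta> + 1 - h)" using \<open>h \<le> \<delta>\<close> \<open>0 < h\<close> by simp
    moreover have "(\<Sum>k\<in>B. r k) = 0" using True by simp
    ultimately have "(\<Sum>i<h. m i) \<noteq> 0" using enough by linarith
    then show ?thesis by (auto simp: sum_eq_0_iff)
  next
    case False
    then show ?thesis using Bm by (auto simp: B_def)
  qed
  then obtain i p0 where p0: "p0 < c" "i < h" "E (w i) (C ! p0)"
    by (auto simp: m_def card_gt_0_iff)
  consider (total) "(h + 1) * ((\<Sum>p<c. card (S p)) + (\<Sum>j\<in>B. r j)) \<le> h * c"
    | (single) j where "j \<in> B" "\<And>p. p < c \<Longrightarrow> S p \<subseteq> {j}"
    | (heavy) j where "j \<in> B" "(h + 1) * card {p. p < c \<and> j \<in> S p} \<le> c"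
  proof (rule marked_cycle_weight[of c S h q B r p0])
    show "S p0 \<noteq> {}" using p0 by (auto simp: S_def)
    show "2 * r j + 2 \<le> h" if "j \<in> B" for j
      using that two_r_le by (auto simp: B_def)
  qed (use p0 gap_diff gap_same in \<open>auto simp: S_def B_def\<close>)
  then show ?thesis
  proof cases
    case total
    have "h * ((h + 1) * (\<delta> + 1 - h)) = (h + 1) * (h * (\<delta> + 1 - h))"
      by (simp only: ac_simps)
    also have "\<dots> \<le> (h + 1) * ((\<Sum>p<c. card (S p)) + (\<Sum>j\<in>B. r j))"
      using enough sum_m by (intro mult_le_mono) auto
    also have "\<dots> \<le> h * c" by (rule total)
    finally show ?thesis using \<open>0 < h\<close> by simp
  next
    case single
    have j: "j < h" "0 < q j" "2 \<le> h"
      using single(1) two_r_le[of j] by (auto simp: B_def)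
    \<comment> \<open>This outcome is contradictory. The ends other than \<open>w j\<close> have no
      neighbours on C, so their paths must be trivial; but the successor of \<open>H ! j\<close> on
      H is not adjacent to \<open>Q j ! 1\<close> and so has too few neighbours.\<close>
    have big: "h \<le> d i" if "i < h" "i \<noteq> j" for i
    proof -
      have "{p. p < c \<and> E (w i) (C ! p)} = {}"
        using single(2) that by (fastforce simp: S_def)
      then have "m i = 0" by (simp add: m_def)
      then show ?thesis using dm[OF that(1)] True by simp
    qed
    have triv: "q i = 0" if "i < h" "i \<noteq> j" for i
      using big[OF that] d_nontrivial[OF that(1)] by (cases "q i") auto
    define i where "i = Suc j mod h"
    have i: "i < h" "i \<noteq> j"
      using j by (auto simp: i_def mod_Suc)
    have "E (Q j ! 0) (Q j ! 1)"
      using gpath_nth_Suc[of \<Gamma> "Q j" 0] Q_props[OF j(1)] j by simp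
    then have "\<not> E (H ! i) (Q j ! 1)"
      unfolding i_def using Q_nth_notin_H[of j 1] Q_props(8)[OF j(1)] j
      by (intro no_consecutive_nbrs) auto
    then have "{k. k < h \<and> 0 < q k \<and> E (H ! i) (Q k ! 1)} = {}"
      using triv by fastforce
    then have "d i + 1 \<le> h"
      using d_trivial[OF i(1) triv[OF i]] by (simp only: card.empty add_0_right)
    then show ?thesis using big[OF i] by simp
  next
    case heavy
    have "{p. p < c \<and> j \<in> S p} = {p. p < c \<and> E (w j) (C ! p)}"
      using heavy(1) by (auto simp: S_def B_def)
    then have "(h + 1) * m j \<le> c"
      using heavy(2) by (simp add: m_def)
    \<comment> \<open>The end \<open>w j\<close> alone has enough neighbours on C, because
      \<open>d j \<le> h - 1\<close>.\<close>
    moreover have "(h + 1) * (\<delta> + 1 - h) \<le> (h + 1) * m j"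
      using Bm heavy(1) by (intro mult_le_mono) auto
    ultimately show ?thesis by simp
  qed
qed

end

theorem (in two_cycles) length_longest_cycle_ge:
  assumes "\<And>v. v \<in> V \<Longrightarrow> \<delta> \<le> card (nbrs V v)"
  shows "(h + 1) * (\<delta> + 1 - h) \<le> c"
proof -
  obtain Q where "path_system Q" "\<And>Q'. path_system Q' \<Longrightarrow> weight Q' \<le> weight Q"
    using ex_maximal_path_system by blast
  then interpret maximal_path_system E V C H Q
    by unfold_locales
  show ?thesis
    using assms by (rule length_longest_cycle_ge_maximal)
qed

section \<open>Application to graphs\<close>

lemma set_vwalk_arcs_subset_iff: "set (vwalk_arcs p) \<subseteq> R \<longleftrightarrow> successively (\<lambda>x y. (x, y) \<in> R) p"
  by (induction p rule: vwalk_arcs.induct) auto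

lemma arcs_ends_induce_subgraph: "arcs_ends (G \<restriction> A) = arcs_ends G \<inter> A \<times> A"
  by (auto simp: arcs_ends_conv induce_subgraph_def)

context graph
begin

interpretation sgraph "dominates G"
  using sym_arcs adj_not_same by unfold_locales (auto simp: symmetric_def dest: symD)

lemma graph_cycle_induce_subgraph_iff: "graph_cycle (G \<restriction> A) p \<longleftrightarrow> gcycle A p"
proof -
  have "successively (\<lambda>x y. (x, y) \<in> arcs_ends G \<inter> A \<times> A) p \<longleftrightarrow>
      successively (\<lambda>x y. (x, y) \<in> arcs_ends G) p" if "set p \<subseteq> A"
    using that by (intro successively_cong) auto
  moreover have "hd p \<in> A" "last p \<in> A" if "set p \<subseteq> A" "p \<noteq> []"
    using that by auto
  ultimately show ?thesis
    unfolding graph_cycle_def gcycle_def gpath_def vpath_def vwalk_def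
      set_vwalk_arcs_subset_iff arcs_ends_induce_subgraph
    by auto
qed

lemma graph_cycle_iff: "graph_cycle G p \<longleftrightarrow> gcycle (verts G) p"
  by (auto simp: graph_cycle_def gcycle_def gpath_def vpath_def vwalk_def set_vwalk_arcs_subset_iff)

lemma out_degree_eq_card_nbrs: "out_degree G v = card (nbrs (verts G) v)"
proof -
  have "inj_on (head G) (out_arcs G v)"
    using inj_on_arc_to_ends by (auto simp: inj_on_def out_arcs_def arc_to_ends_def)
  moreover have "head G ` out_arcs G v = nbrs (verts G) v"
    unfolding nbrs_def out_arcs_def by (auto simp: arcs_ends_conv)
  ultimately show ?thesis
    unfolding out_degree_def by (metis card_image)
qed

lemma ex_longest_eq_circumference:
  assumes "A \<subseteq> verts G" "A \<noteq> {}"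
  obtains H where "longest A H" "length H = circumference (G \<restriction> A)"
proof -
  let ?L = "length ` {p. gcycle A p}"
  have "finite A"
    using assms(1) finite_verts by (rule finite_subset)
  then have "?L \<subseteq> {..card A}"
    using gpath_length_le by (auto simp: gcycle_def)
  then have fin: "finite ?L"
    by (rule finite_subset) simp
  obtain v where "v \<in> A" using assms(2) by blast
  then have "gcycle A [v]" by (simp add: gcycle_def)
  then have "Max ?L \<in> ?L"
    using fin by (intro Max_in) auto
  then obtain H where H: "gcycle A H" "length H = Max ?L" by auto
  have "longest A H"
    unfolding longest_def using H fin by auto
  moreover have "Collect (graph_cycle (G \<restriction> A)) = Collect (gcycle A)"
    using graph_cycle_induce_subgraph_iff by blast
  then have "length H = circumference (G \<restriction> A)"
    using assms(2) H(2) by (simp add: circumference_def)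
  ultimately show ?thesis by (rule that)
qed

text \<open>The vertices of a longest cycle in the complement are added to the bound for C. If C is
  spanning, then h = 0 and the claim is that the minimum degree is less than the order.\<close>

lemma card_verts_ge_of_longest_cycle:
  assumes "longest_cycle G C"
  defines "h \<equiv> circumference (G \<restriction> (verts G - set C))"
  shows "(h + 1) * (min_degree G + 1 - h) + h \<le> card (verts G)"
proof -
  have C: "longest (verts G) C"
    using assms(1) by (simp add: longest_cycle_def longest_def graph_cycle_iff)
  then have cC: "card (set C) = length C" "set C \<subseteq> verts G" "C \<noteq> []"
    by (auto simp: longest_def gcycle_def gpath_def distinct_card)
  have deg: "min_degree G \<le> card (nbrs (verts G) v)" if "v \<in> verts G" for v
    unfolding min_degree_def out_degree_eq_card_nbrs[symmetric] using that by simp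
  show ?thesis
  proof (cases "verts G - set C = {}")
    case True
    obtain v where v: "v \<in> verts G" using cC by (cases C) auto
    have "nbrs (verts G) v \<subset> verts G"
      using v irrefl by (auto simp: nbrs_def)
    with finite_verts have "card (nbrs (verts G) v) < card (verts G)"
      by (rule psubset_card_mono)
    then have "min_degree G < card (verts G)"
      using deg[OF v] by simp
    moreover have "h = 0"
      using True by (simp add: h_def circumference_def)
    ultimately show ?thesis by simp
  next
    case False
    then obtain H where H: "longest (verts G - set C) H" "length H = h"
      using ex_longest_eq_circumference[of "verts G - set C"] unfolding h_def by blast
    interpret two_cycles "dominates G" "verts G" C H
      using C H by unfold_locales auto
    have "(h + 1) * (min_degree G + 1 - h) \<le> length C"
      using length_longest_cycle_ge[OF deg] H(2) by simp
    moreover have "h \<le> card (verts G - set C)"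
      using gpath_length_le[OF H_props(1)] H(2) by simp
    moreover have "card (verts G) = length C + card (verts G - set C)"
      using cC card_Diff_subset[of "set C" "verts G"] card_mono[OF finite_verts cC(2)] by simp
    ultimately show ?thesis by simp
  qed
qed

end

section \<open>The dichotomy by integer arithmetic\<close>

theorem theorem3:
  fixes G :: "('a, 'b) pre_digraph" and C :: "'a list"
    and l n \<delta> cbar :: nat
  assumes "l \<ge> 1"
    and "graph G"
    and "n = card (verts G)"
    and "\<delta> = min_degree G"
    and "longest_cycle G C"
    and "cbar = circumference (G \<restriction> (verts G - set C))"
    and "real \<delta> \<ge> (real n + 2) / (real l + 1) + real l - 2"
  shows "int cbar \<le> min (int l - 1) (int \<delta> - int l) \<or>
         int cbar \<ge> max (int l + 1) (int \<delta> - int l + 2)"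
proof -
  interpret graph G by fact
  define h where "h = int cbar"
  define D where "D = int \<delta>"
  define L where "L = int l"
  have "(cbar + 1) * (\<delta> + 1 - cbar) + cbar \<le> n"
    using card_verts_ge_of_longest_cycle[OF assms(5)] assms(3,4,6) by simp
  then have "int ((cbar + 1) * (\<delta> + 1 - cbar) + cbar) \<le> int n"
    by (simp only: of_nat_le_iff)
  then have "(h + 1) * int (\<delta> + 1 - cbar) + h \<le> int n"
    unfolding h_def by (simp only: of_nat_add of_nat_mult of_nat_1)
  \<comment> \<open>Truncated subtraction can only enlarge the factor, so the bound survives in the
    integers.\<close>
  moreover have "(h + 1) * (D + 1 - h) \<le> (h + 1) * int (\<delta> + 1 - cbar)"
    unfolding h_def D_def by (intro mult_left_mono) auto
  ultimately have lower: "(h + 1) * (D + 1 - h) + h \<le> int n"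
    by simp
  have "(real n + 2) / (real l + 1) \<le> real \<delta> - real l + 2"
    using assms(7) by simp
  then have "real n + 2 \<le> (real \<delta> - real l + 2) * (real l + 1)"
    by (simp add: pos_divide_le_eq)
  then have "real_of_int (int n + 2) \<le> real_of_int ((D - L + 2) * (L + 1))"
    by (simp add: D_def L_def)
  then have "int n + 2 \<le> (D - L + 2) * (L + 1)"
    by (simp only: of_int_le_iff)
  \<comment> \<open>The left side is nonnegative by the two bounds on n, so the constant -1 makes
    the product strictly positive.\<close>
  moreover have "(D - L + 2) * (L + 1) - (h + 1) * (D + 1 - h) - h - 2 = (L - h) * (D + 1 - L - h) - 1"
    by (simp add: algebra_simps)
  ultimately have "0 < (L - h) * (D + 1 - L - h)"
    using lower by linarith
  then have "(h < L \<and> h \<le> D - L) \<or> (L < h \<and> D - L + 2 \<le> h)"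
    by (auto simp: zero_less_mult_iff)
  then show ?thesis
    unfolding h_def D_def L_def by auto
qed

end
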